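(* For an integer $d\ge4$, the polynomial $$f_d=\sum_{j=0}^{d-1}(-1)^j\prod_{i=0}^{j-1}(X-i)\in\mathbb{Z}[X]$$ (of degree $d-1$) has exactly $d-1$ real roots and exactly one rational root, namely $1$.
   Context: Empty products equal $1$. (These polynomials arise in the identity $D_n=D_{n-d}\prod_{i=0}^{d-1}(n-i)+(-1)^nf_d(n)$, $n\ge d$, for the numbers of derangements $D_0=1$, $D_n=nD_{n-1}+(-1)^n$.) *)

theory Defs
  imports Complex_Main "HOL-Computational_Algebra.Polynomial"
begin

definition f_poly :: "nat \<Rightarrow> int poly" where
  "f_poly d = (\<Sum>j<d. (-1) ^ j * (\<Prod>i<j. [:- int i, 1:]))"

end

theory Submission
  imports Defs
begin

text \<open>
  For \<open>n < d\<close> the value \<open>f_d(n)\<close> is, up to the sign \<open>(-1)^n\<close>, the number of derangements of \<open>n\<close>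
  points, so \<open>f_d\<close> changes sign between consecutive integers in \<open>{2, \<dots>, d - 1}\<close>; this gives
  \<open>d - 3\<close> roots. Moreover \<open>f_d(1) = 0\<close>, and \<open>f_d(0) = 1\<close> and \<open>f_d(1/2) < 0\<close> yield a root in
  \<open>(0, 1/2)\<close>. These are \<open>d - 1\<close> roots of a polynomial of degree \<open>d - 1\<close>, hence all of them.
  As \<open>f_d\<close> is monic up to sign its rational roots are integers, but all roots except \<open>1\<close> lie
  strictly between consecutive integers.
\<close>

text \<open>The value of \<open>f_poly d\<close> at \<open>x\<close>, over an arbitrary commutative
  ring so that one recursion serves real and rational arguments alike.\<close>

definition alt_ff_sum :: "nat \<Rightarrow> 'a::comm_ring_1 \<Rightarrow> 'a" where
  "alt_ff_sum d x = (\<Sum>j<d. (-1) ^ j * (\<Prod>i<j. x - of_nat i))"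

lemma map_poly_of_int_add:
  "map_poly of_int (p + q) = (map_poly of_int p + map_poly of_int q :: 'a::comm_ring_1 poly)"
  by (intro poly_eqI) (simp add: coeff_map_poly)

lemma map_poly_of_int_mult:
  "map_poly of_int (p * q) = (map_poly of_int p * map_poly of_int q :: 'a::comm_ring_1 poly)"
  by (intro poly_eqI) (simp add: coeff_map_poly coeff_mult)

lemma map_poly_of_int_minus:
  "map_poly of_int (- p) = (- map_poly of_int p :: 'a::comm_ring_1 poly)"
  by (intro poly_eqI) (simp add: coeff_map_poly)

lemma map_poly_of_int_sum:
  "map_poly of_int (\<Sum>i\<in>A. g i) = (\<Sum>i\<in>A. map_poly of_int (g i) :: 'a::comm_ring_1 poly)"
  by (induction A rule: infinite_finite_induct) (simp_all add: map_poly_of_int_add)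

lemma map_poly_of_int_prod:
  "map_poly of_int (\<Prod>i\<in>A. g i) = (\<Prod>i\<in>A. map_poly of_int (g i) :: 'a::comm_ring_1 poly)"
  by (induction A rule: infinite_finite_induct) (simp_all add: map_poly_of_int_mult)

lemma map_poly_of_int_power:
  "map_poly of_int (p ^ n) = (map_poly of_int p ^ n :: 'a::comm_ring_1 poly)"
  by (induction n) (simp_all add: map_poly_of_int_mult)

lemma poly_f_poly:
  "poly (map_poly of_int (f_poly d)) (x :: 'a::comm_ring_1) = alt_ff_sum d x"
  by (simp add: f_poly_def alt_ff_sum_def map_poly_of_int_sum map_poly_of_int_mult
      map_poly_of_int_prod map_poly_of_int_power map_poly_of_int_minus map_poly_pCons
      poly_sum poly_prod)

lemma of_rat_alt_ff_sum:
  "of_rat (alt_ff_sum d x) = (alt_ff_sum d (of_rat x) :: 'a::field_char_0)"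
  by (simp add: alt_ff_sum_def of_rat_sum of_rat_mult of_rat_prod of_rat_power of_rat_diff
      of_rat_minus)

text \<open>Each new summand has larger degree than all earlier ones together, so it alone fixes the
  degree and the leading coefficient.\<close>

lemma degree_lead_coeff_f_poly:
  "degree (f_poly (Suc n)) = n \<and> lead_coeff (f_poly (Suc n)) = (-1) ^ n"
proof (induction n)
  case 0
  show ?case by (simp add: f_poly_def)
next
  case (Suc n)
  define t where "t = (-1) ^ Suc n * (\<Prod>i<Suc n. [:- int i, 1:])"
  have t: "t = smult ((-1) ^ Suc n) (\<Prod>i<Suc n. [:- int i, 1:])"
    by (cases "even n") (simp_all add: t_def)
  have deg: "degree t = Suc n"
    unfolding t degree_smult_eq by (subst degree_prod_eq_sum_degree) auto
  have "lead_coeff t = (-1) ^ Suc n"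
    unfolding t lead_coeff_smult lead_coeff_prod by simp
  moreover have "f_poly (Suc (Suc n)) = f_poly (Suc n) + t"
    by (simp add: f_poly_def t_def)
  moreover have "degree (f_poly (Suc n)) < degree t"
    using Suc deg by simp
  ultimately show ?case
    using deg by (simp add: degree_add_eq_right coeff_eq_0)
qed

text \<open>Split off the summand \<open>j = 0\<close>; every other product contains the factor
  \<open>x\<close>, and what remains is a falling factorial of \<open>x - 1\<close>.\<close>

lemma alt_ff_sum_Suc:
  "alt_ff_sum (Suc d) x = 1 - x * alt_ff_sum d (x - 1)"
proof -
  have "(\<Prod>i<Suc j. x - of_nat i) = x * (\<Prod>i<j. x - 1 - of_nat i)" for j
    by (subst prod.lessThan_Suc_shift) (simp add: algebra_simps)
  then show ?thesis
    unfolding alt_ff_sum_def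
    by (subst sum.lessThan_Suc_shift)
      (simp add: sum_distrib_left sum_negf algebra_simps del: prod.lessThan_Suc)
qed

lemma alt_ff_sum_0 [simp]: "d > 0 \<Longrightarrow> alt_ff_sum d 0 = 1"
  by (cases d) (simp_all add: alt_ff_sum_Suc)

lemma alt_ff_sum_1: "d > 1 \<Longrightarrow> alt_ff_sum d 1 = 0"
  by (cases d) (simp_all add: alt_ff_sum_Suc)

text \<open>The recursion becomes that of the derangement numbers,
  \<open>D (n + 1) = (n + 1) * D n + (-1) ^ (n + 1)\<close>. The bound 1 instead of mere positivity
  makes the induction work: the factor \<open>n + 1\<close> is at least 2 and absorbs a possible
  \<open>-1\<close>.\<close>

lemma alt_ff_sum_of_nat_sign:
  assumes "n \<ge> 2" "n < d"
  shows "(-1) ^ n * alt_ff_sum d (real n) \<ge> 1"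
  using assms
proof (induction n arbitrary: d rule: dec_induct)
  case base
  then obtain e where "d = Suc e" "e > 1"
    by (cases d) auto
  then show ?case
    by (simp add: alt_ff_sum_Suc alt_ff_sum_1)
next
  case (step n)
  then obtain e where d: "d = Suc e" "n < e"
    by (cases d) auto
  define v where "v = (-1) ^ n * alt_ff_sum e (real n)"
  have eq: "(-1) ^ Suc n * alt_ff_sum d (real (Suc n)) = (-1) ^ Suc n + real (Suc n) * v"
    by (simp add: d alt_ff_sum_Suc v_def algebra_simps)
  have "v \<ge> 1"
    using step.IH d by (simp add: v_def)
  then have "2 * 1 \<le> real (Suc n) * v"
    using \<open>2 \<le> n\<close> by (intro mult_mono) auto
  moreover have "(-1 :: real) ^ Suc n \<ge> -1"
    by (cases "even n") simp_all
  ultimately have "1 \<le> (-1) ^ Suc n + real (Suc n) * v"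
    by linarith
  with eq show ?case
    by (simp only:)
qed

text \<open>For \<open>x \<le> 0\<close> the signs cancel and all summands are nonnegative.\<close>

lemma alt_ff_sum_mono_neg:
  fixes x :: real
  assumes "x \<le> 0" "c \<le> d"
  shows "alt_ff_sum c x \<le> alt_ff_sum d x"
  unfolding alt_ff_sum_def
proof (rule sum_mono2)
  fix j
  have "(-1) ^ j * (\<Prod>i<j. x - real i) = (\<Prod>i<j. real i - x)"
    by (induction j) (auto simp: algebra_simps)
  then show "0 \<le> (-1) ^ j * (\<Prod>i<j. x - real i)"
    using assms by (auto intro!: prod_nonneg)
qed (use assms in auto)

lemma alt_ff_sum_half_neg:
  assumes "d \<ge> 4"
  shows "alt_ff_sum d (1 / 2 :: real) < 0"
proof -
  obtain e where e: "d = Suc e" "e \<ge> 3"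
    using assms by (cases d) auto
  \<comment> \<open>The recursion gives \<open>1 - alt_ff_sum e (- 1 / 2) / 2\<close>, so a value
    above 2 is required; three summands, 1 + 1/2 + 3/4, already suffice.\<close>
  have "9 / 4 = alt_ff_sum 3 (- 1 / 2 :: real)"
    by (simp add: alt_ff_sum_def eval_nat_numeral)
  also have "\<dots> \<le> alt_ff_sum e (- 1 / 2)"
    using e by (intro alt_ff_sum_mono_neg) auto
  finally show ?thesis
    by (simp add: e alt_ff_sum_Suc)
qed

theorem mainTheorem9:
  fixes d :: nat
  assumes "d \<ge> 4"
  shows "degree (f_poly d) = d - 1
    \<and> card {x :: real. poly (map_poly of_int (f_poly d)) x = 0} = d - 1
    \<and> {x :: rat. poly (map_poly of_int (f_poly d)) x = 0} = {1}"
proof -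
  let ?p = "map_poly of_int (f_poly d) :: real poly"
  define R where "R = {x. poly ?p x = 0}"
  have deg: "degree (f_poly d) = d - 1" and lc: "lead_coeff (f_poly d) = (-1) ^ (d - 1)"
    using degree_lead_coeff_f_poly[of "d - 1"] Suc_diff_1[of d] assms by auto
  have deg': "degree ?p = d - 1" and lc': "lead_coeff ?p = (-1) ^ (d - 1)"
    using deg lc by (simp_all add: degree_map_poly coeff_map_poly)
  then have "?p \<noteq> 0"
    by auto
  then have fin: "finite R" and card_le: "card R \<le> d - 1"
    using poly_roots_finite card_poly_roots_bound deg' unfolding R_def by metis+

  \<comment> \<open>Half-open intervals are disjoint, so the roots are distinct; the last conjunct
    records that only the root 1 sits at an endpoint.\<close>
  have "\<exists>r\<in>R. real k \<le> r \<and> r < real k + 1 \<and> (r = real k \<longrightarrow> k = 1)" if "k < d - 1" for k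
  proof -
    consider "k = 0" | "k = 1" | "k \<ge> 2" by linarith
    then show ?thesis
    proof cases
      case 1
      have "\<exists>x>0. x < 1 / 2 \<and> poly ?p x = 0"
        using alt_ff_sum_half_neg[OF assms] assms by (intro poly_IVT) (simp_all add: poly_f_poly)
      then show ?thesis
        using 1 by (force simp: R_def)
    next
      case 2
      then show ?thesis
        using assms by (intro bexI[of _ 1]) (simp_all add: R_def poly_f_poly alt_ff_sum_1)
    next
      case 3
      define v w where "v = poly ?p (real k)" and "w = poly ?p (real k + 1)"
      have "(-1) ^ k * v \<ge> 1" "(-1) ^ Suc k * w \<ge> 1"
        using alt_ff_sum_of_nat_sign[of k d] alt_ff_sum_of_nat_sign[of "Suc k" d] 3 that
        by (simp_all add: poly_f_poly v_def w_def add.commute)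
      then have "v * w < 0"
        by (cases "even k") (auto simp: mult_less_0_iff)
      then have "\<exists>x>real k. x < real k + 1 \<and> poly ?p x = 0"
        unfolding v_def w_def by (intro poly_IVT) simp_all
      then show ?thesis
        by (force simp: R_def)
    qed
  qed
  then obtain r where r: "\<And>k. k < d - 1 \<Longrightarrow> r k \<in> R"
      "\<And>k. k < d - 1 \<Longrightarrow> real k \<le> r k \<and> r k < real k + 1 \<and> (r k = real k \<longrightarrow> k = 1)"
    by metis
  have floor_r: "\<lfloor>r k\<rfloor> = int k" if "k < d - 1" for k
    using r(2)[OF that] by (simp add: floor_eq_iff)
  have "inj_on r {..<d - 1}"
    by (intro inj_onI) (metis floor_r lessThan_iff of_nat_eq_iff)
  then have card_im: "card (r ` {..<d - 1}) = d - 1"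
    by (simp add: card_image)
  have im: "r ` {..<d - 1} = R"
    using r(1) card_im card_le by (intro card_seteq fin) auto

  have rat_root: "x = 1" if "poly (map_poly of_int (f_poly d)) x = 0" for x :: rat
  proof -
    have "alt_ff_sum d (of_rat x :: real) = 0"
      using that by (simp add: poly_f_poly flip: of_rat_alt_ff_sum)
    then have root: "of_rat x \<in> R"
      by (simp add: R_def poly_f_poly)
    \<comment> \<open>Multiplying by the sign \<open>(-1) ^ (d - 1)\<close> makes the polynomial
      monic with integer coefficients, so a rational root is an integer.\<close>
    have "algebraic_int (of_rat x :: real)"
    proof (rule algebraic_int.intros)
      show "lead_coeff (smult ((-1) ^ (d - 1)) ?p) = 1"
        using lc' by (simp flip: power_mult_distrib)
    qed (use root in \<open>auto simp: R_def coeff_map_poly\<close>)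
    then obtain m where m: "of_rat x = real_of_int m"
      using rational_algebraic_int_is_int by (metis Ints_cases Rats_of_rat)
    obtain k where k: "k < d - 1" "of_rat x = r k"
      using root im by auto
    \<comment> \<open>An integer equals its floor, which for \<open>r k\<close> is \<open>k\<close>;
      the endpoint condition then forces \<open>k = 1\<close>.\<close>
    then have "r k = real k"
      using m floor_r[of k] by (metis floor_of_int of_int_of_nat_eq)
    then have "of_rat x = (1 :: real)"
      using r(2) k by simp
    then show "x = 1"
      by simp
  qed
  have "poly (map_poly of_int (f_poly d)) (1 :: rat) = 0"
    using assms by (simp add: poly_f_poly alt_ff_sum_1)
  then show ?thesis
    using deg card_im im rat_root by (auto simp: R_def)
qed

end
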